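(* Let $p \ge 1$ and $n \ge 0$ be integers with $(p,n)\neq(1,0)$, and let $C_0 = 2^{p}n + 2^{p-1} - 1$. Then the first $2p-1$ steps of the Collatz sequence of $C_0$ consist of $p-1$ odd steps and $p$ even steps: they are odd and even steps alternating (an odd step followed by an even step, $p-1$ times), followed by one further even step. The number reached after these $2p-1$ steps is $$C_{2p-1} = 3^{p-1}n + \frac{3^{p-1}-1}{2}.$$
   Context: The Collatz sequence of a natural number $C_0\ge 1$ is defined by $C_{i+1} = 3C_i+1$ if $C_i$ is odd (an odd step) and $C_{i+1} = C_i/2$ if $C_i$ is even (an even step). The $2p-1$ steps in the claim are what is called a cascade, and $C_{2p-1}$ is called the cascade transform of $C_0$. *)

theory Defs
  imports Complex_Main
begin

definition collatz_step :: "nat \<Rightarrow> nat" where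
  "collatz_step m = (if odd m then 3 * m + 1 else m div 2)"

(* The Collatz sequence C_0, C_1, ... of a starting value c = C_0; meaningful only for c >= 1.
   The step from C_i to C_{i+1} is an odd (even) step iff C_i is odd (even). *)
primrec collatz :: "nat \<Rightarrow> nat \<Rightarrow> nat" where
  "collatz c 0 = c"
| "collatz c (Suc i) = collatz_step (collatz c i)"

end

(* Writing C_0 + 1 = 2^q * (2n + 1) with q = p - 1, an odd step followed by an even step
   multiplies C + 1 by 3/2, so C_{2j} + 1 = 3^j * 2^(q - j) * (2n + 1) for j <= q.
   Hence C_{2j} is odd exactly as long as j < q. *)
theory Submission
  imports Defs
begin

text \<open>For \<open>j < q\<close> a factor 2 is left in \<open>collatz c (2 * j) + 1\<close>, so
  the term is odd and the induction can pass through an odd step and an even step.\<close>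

lemma collatz_even_index:
  assumes "c + 1 = 2 ^ q * m" and "j \<le> q"
  shows "collatz c (2 * j) + 1 = 3 ^ j * 2 ^ (q - j) * m"
  using assms(2)
proof (induction j)
  case 0
  then show ?case using assms(1) by simp
next
  case (Suc j)
  define x where "x = collatz c (2 * j)"
  \<comment> \<open>\<open>y\<close> is half of \<open>x + 1\<close>, so the two steps give
    \<open>(3 * x + 1) div 2 + 1 = 3 * y\<close>.\<close>
  define y where "y = 3 ^ j * 2 ^ (q - Suc j) * m"
  have "q - j = Suc (q - Suc j)" using Suc.prems by simp
  then have x: "x + 1 = 2 * y" using Suc by (simp add: x_def y_def)
  then have "odd x" by presburger
  then have "collatz c (2 * Suc j) = (3 * x + 1) div 2"
    by (simp add: collatz_step_def x_def)
  then have "collatz c (2 * Suc j) + 1 = 3 * y" using x by linarith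
  then show ?case by (simp add: y_def)
qed

theorem mainTheorem2:
  fixes p n :: nat and C :: "nat \<Rightarrow> nat"
  assumes "p \<ge> 1"
    and "(p, n) \<noteq> (1, 0)"
    and "C = collatz (2 ^ p * n + 2 ^ (p - 1) - 1)"
  shows "C 0 \<ge> 1
    \<and> card {i. i < 2 * p - 1 \<and> odd (C i)} = p - 1
    \<and> card {i. i < 2 * p - 1 \<and> even (C i)} = p
    \<and> (\<forall>j < p - 1. odd (C (2 * j)) \<and> even (C (2 * j + 1)))
    \<and> even (C (2 * p - 2))
    \<and> real (C (2 * p - 1)) = 3 ^ (p - 1) * real n + (3 ^ (p - 1) - 1) / 2"
proof -
  obtain q where p: "p = Suc q" using assms(1) by (cases p) auto
  define c :: nat where "c = 2 ^ p * n + 2 ^ (p - 1) - 1"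
  have C: "C = collatz c" using assms(3) by (simp add: c_def)
  have c: "c + 1 = 2 ^ q * (2 * n + 1)" by (simp add: c_def p algebra_simps)
  \<comment> \<open>This rules out \<open>c = 0\<close>. For \<open>q = 0\<close> it amounts to
    \<open>n \<ge> 1\<close>, which is what excluding \<open>(1, 0)\<close> provides; otherwise the
    power of 2 suffices.\<close>
  have "(2::nat) \<le> 2 ^ q * (2 * n + 1)"
  proof (cases q)
    case 0
    then show ?thesis using assms(2) p by simp
  next
    case (Suc r)
    have "(0::nat) < 2 ^ r * (2 * n + 1)" by (intro mult_pos_pos) simp_all
    then show ?thesis unfolding Suc power_Suc by linarith
  qed
  then have pos: "C 0 \<ge> 1" using c by (simp add: C)
  have C_even: "C (2 * j) + 1 = 3 ^ j * 2 ^ (q - j) * (2 * n + 1)" if "j \<le> q" for j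
    unfolding C by (rule collatz_even_index[OF c that])
  have odd: "odd (C (2 * j))" if "j < q" for j
  proof -
    have "even (C (2 * j) + 1)" using C_even[of j] that by simp
    then show ?thesis by simp
  qed
  have even: "even (C (2 * j + 1))" if "j < q" for j
    using odd[OF that] by (simp add: C collatz_step_def)
  have last: "C (2 * q) + 1 = 3 ^ q * (2 * n + 1)" using C_even[of q] by simp
  \<comment> \<open>At \<open>j = q\<close> the powers of 2 are used up and only odd factors remain,
    which forces the extra even step.\<close>
  have "odd (C (2 * q) + 1)" unfolding last by simp
  then have last_even: "even (C (2 * q))" by simp
  \<comment> \<open>Odd positions hold even values, and so does the last position
    \<open>2 * q\<close>; this leaves only \<open>2 * j\<close> with \<open>j < q\<close>.\<close>
  have odd_index: "i \<in> (\<lambda>j. 2 * j) ` {..<q}" if "i < 2 * q + 1" and "odd (C i)" for i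
  proof (cases "even i")
    case True
    then obtain j where "i = 2 * j" by blast
    then show ?thesis using that last_even by (cases "j = q") auto
  next
    case False
    then obtain j where "i = 2 * j + 1" by (rule oddE)
    then show ?thesis using that even[of j] by auto
  qed
  have "{i. i < 2 * q + 1 \<and> odd (C i)} = (\<lambda>j. 2 * j) ` {..<q}"
  proof (intro set_eqI iffI)
    fix i
    assume "i \<in> {i. i < 2 * q + 1 \<and> odd (C i)}"
    then show "i \<in> (\<lambda>j. 2 * j) ` {..<q}" using odd_index by blast
  next
    fix i
    assume "i \<in> (\<lambda>j. 2 * j) ` {..<q}"
    then obtain j where "i = 2 * j" and "j < q" by blast
    then show "i \<in> {i. i < 2 * q + 1 \<and> odd (C i)}" using odd[of j] by simp
  qed
  then have card_odd: "card {i. i < 2 * q + 1 \<and> odd (C i)} = q"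
    by (simp add: card_image inj_on_def)
  \<comment> \<open>Even steps are counted as the complement:
    \<open>2 * q + 1 - q = Suc q\<close>.\<close>
  have "{i. i < 2 * q + 1 \<and> even (C i)} = {..<2 * q + 1} - {i. i < 2 * q + 1 \<and> odd (C i)}"
    by auto
  then have card_even: "card {i. i < 2 * q + 1 \<and> even (C i)} = Suc q"
    using card_odd by (simp add: card_Diff_subset subset_iff)
  have "C (2 * q) = 2 * C (2 * q + 1)"
    using last_even by (simp add: C collatz_step_def)
  \<comment> \<open>Moving to the reals lets the equation be solved by dividing by 2.\<close>
  then have "real (2 * C (2 * q + 1) + 1) = real (3 ^ q * (2 * n + 1))"
    using last by simp
  then have "real (C (2 * q + 1)) = 3 ^ q * real n + (3 ^ q - 1) / 2"
    by (simp add: field_simps)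
  then show ?thesis
    using pos card_odd card_even odd even last_even by (simp add: p)
qed

end
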